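(* Let $Cr_{10}$ be the crown graph on $10$ vertices. Then $\mathrm{gon}_2(Cr_{10})=10-\alpha_2(Cr_{10})$.
   Context: The crown graph $Cr_{2n}$ is the complete bipartite graph $K_{n,n}$ with a perfect matching removed; $Cr_{10}$ is obtained from $K_{5,5}$. $\alpha_2(G)$ is the maximum size of a set of vertices with pairwise graph distance greater than $2$. A divisor is a formal integer combination $D=\sum_v D(v)(v)$ of vertices, $\deg D=\sum_v D(v)$, effective if all $D(v)\ge0$. Firing a vertex $v$ transforms $D$ into $D'$ with $D'(v)=D(v)-\mathrm{val}(v)$ and $D'(w)=D(w)+(\text{number of edges between } v,w)$ for $w\ne v$; linear equivalence is generated by firings. The rank $r(D)$ is $-1$ if $D$ is not equivalent to an effective divisor, and otherwise the largest $r\ge0$ such that $D-E$ is equivalent to an effective divisor for every effective $E$ of degree $r$. $\mathrm{gon}_2(G)$ is the minimum degree of a divisor of rank at least $2$. *)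

theory Defs
  imports "Graph_Theory.Graph_Theory"
begin

section \<open>Crown graphs\<close>

text \<open>
  Following \<^theory>\<open>Graph_Theory.Digraph\<close>, an undirected graph is a symmetric digraph: each edge
  is a pair of opposite arcs. The sides of \<open>K\<^sub>n\<^sub>,\<^sub>n\<close> are the vertices \<open>Inl i\<close> and \<open>Inr i\<close>, \<open>i < n\<close>, and
  the perfect matching that is removed joins \<open>Inl i\<close> to \<open>Inr i\<close>. The parameter \<open>n\<close> is half of the
  number of vertices.
\<close>

definition complete_bipartite_nn :: "nat \<Rightarrow> (nat + nat, (nat + nat) \<times> (nat + nat)) pre_digraph" where
  "complete_bipartite_nn n =
     (let U = Inl ` {..<n}; V = Inr ` {..<n}
      in \<lparr> verts = U \<union> V, arcs = U \<times> V \<union> V \<times> U, tail = fst, head = snd \<rparr>)"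

definition matching_arcs :: "nat \<Rightarrow> ((nat + nat) \<times> (nat + nat)) set" where
  "matching_arcs n = (\<Union>i<n. {(Inl i, Inr i), (Inr i, Inl i)})"

definition crown_graph :: "nat \<Rightarrow> (nat + nat, (nat + nat) \<times> (nat + nat)) pre_digraph" where
  "crown_graph n = (complete_bipartite_nn n)
     \<lparr> arcs := arcs (complete_bipartite_nn n) - matching_arcs n \<rparr>"

lemmas crown_graph_defs =
  crown_graph_def complete_bipartite_nn_def Let_def matching_arcs_def

lemma complete_bipartite_nn: "complete_bipartite_digraph n n (complete_bipartite_nn n)"
  unfolding complete_bipartite_digraph_def
proof (intro conjI exI)
  show "graph (complete_bipartite_nn n)"
    by unfold_locales
      (auto simp: complete_bipartite_nn_def Let_def arc_to_ends_def symmetric_def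
         arcs_ends_def intro!: symI)
  show "verts (complete_bipartite_nn n) = Inl ` {..<n} \<union> Inr ` {..<n}"
    by (simp add: complete_bipartite_nn_def Let_def)
  show "arcs_ends (complete_bipartite_nn n) =
      Inl ` {..<n} \<times> Inr ` {..<n} \<union> Inr ` {..<n} \<times> Inl ` {..<n}"
    by (simp add: complete_bipartite_nn_def Let_def arcs_ends_def arc_to_ends_def)
qed (auto simp: card_image)

lemma crown_graph: "graph (crown_graph n)"
  by unfold_locales
    (auto simp: crown_graph_defs arc_to_ends_def symmetric_def arcs_ends_def intro!: symI)

lemma card_verts_crown_graph: "card (verts (crown_graph n)) = 2 * n"
  by (simp add: crown_graph_defs, subst card_Un_disjoint) (auto simp: card_image)

lemma arcs_ends_crown_graph:
  "(u, v) \<in> arcs_ends (crown_graph n) \<longleftrightarrow>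
     (\<exists>i<n. \<exists>j<n. i \<noteq> j \<and> (u = Inl i \<and> v = Inr j \<or> u = Inr i \<and> v = Inl j))"
  by (auto simp: crown_graph_defs arcs_ends_def arc_to_ends_def)


section \<open>Distance and \<open>\<alpha>\<^sub>k\<close>\<close>

definition graph_dist :: "('a, 'b) pre_digraph \<Rightarrow> 'a \<Rightarrow> 'a \<Rightarrow> ereal" where
  "graph_dist G u v = wf_digraph.\<mu> G (\<lambda>_. 1) u v"

definition alpha :: "nat \<Rightarrow> ('a, 'b) pre_digraph \<Rightarrow> nat" where
  "alpha k G =
     Max {card S |S. S \<subseteq> verts G \<and> (\<forall>u\<in>S. \<forall>v\<in>S. u \<noteq> v \<longrightarrow> graph_dist G u v > ereal (real k))}"


section \<open>Divisors, rank and gonality\<close>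

definition divisors :: "('a, 'b) pre_digraph \<Rightarrow> ('a \<Rightarrow> int) set" where
  "divisors G = {D. \<forall>v. v \<notin> verts G \<longrightarrow> D v = 0}"

definition div_degree :: "('a, 'b) pre_digraph \<Rightarrow> ('a \<Rightarrow> int) \<Rightarrow> int" where
  "div_degree G D = (\<Sum>v\<in>verts G. D v)"

definition effective :: "('a, 'b) pre_digraph \<Rightarrow> ('a \<Rightarrow> int) \<Rightarrow> bool" where
  "effective G D \<longleftrightarrow> (\<forall>v\<in>verts G. D v \<ge> 0)"

text \<open>
  Every edge between \<open>v\<close> and \<open>w\<close> contributes exactly one arc from \<open>v\<close> to \<open>w\<close>, so edges are counted
  by arcs leaving \<open>v\<close>, and the valence is the out-degree.
\<close>

definition num_edges :: "('a, 'b) pre_digraph \<Rightarrow> 'a \<Rightarrow> 'a \<Rightarrow> nat" where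
  "num_edges G v w = card {e \<in> arcs G. tail G e = v \<and> head G e = w}"

definition fire :: "('a, 'b) pre_digraph \<Rightarrow> 'a \<Rightarrow> ('a \<Rightarrow> int) \<Rightarrow> 'a \<Rightarrow> int" where
  "fire G v D = (\<lambda>w. if w = v then D v - int (out_degree G v) else D w + int (num_edges G v w))"

definition lin_equiv :: "('a, 'b) pre_digraph \<Rightarrow> ('a \<Rightarrow> int) \<Rightarrow> ('a \<Rightarrow> int) \<Rightarrow> bool" where
  "lin_equiv G = equivclp (\<lambda>D D'. \<exists>v\<in>verts G. D' = fire G v D)"

definition equiv_effective :: "('a, 'b) pre_digraph \<Rightarrow> ('a \<Rightarrow> int) \<Rightarrow> bool" where
  "equiv_effective G D \<longleftrightarrow> (\<exists>D'\<in>divisors G. lin_equiv G D D' \<and> effective G D')"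

text \<open>
  The maximum exists when \<open>G\<close> is a graph with at least one vertex, because then \<open>r\<close> is at most the
  degree of \<open>D\<close>.
\<close>

definition div_rank :: "('a, 'b) pre_digraph \<Rightarrow> ('a \<Rightarrow> int) \<Rightarrow> int" where
  "div_rank G D =
     (if \<not> equiv_effective G D then -1
      else int (GREATEST r::nat. \<forall>E\<in>divisors G. effective G E \<and> div_degree G E = int r \<longrightarrow>
                  equiv_effective G (\<lambda>v. D v - E v)))"

definition gonality :: "nat \<Rightarrow> ('a, 'b) pre_digraph \<Rightarrow> int" where
  "gonality k G = (LEAST d. \<exists>D\<in>divisors G. div_rank G D \<ge> int k \<and> div_degree G D = d)"

end

theory Submission
  imports Defs
begin

text \<open>
  Two vertices of the crown graph are at distance greater than 2 exactly when they are matched, so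
  \<open>\<alpha>\<^sub>2 = 2\<close>, and the divisor with one chip on all vertices except one matched pair has rank at least 2.

  Conversely let \<open>D\<close> have degree at most 7. Take the effective divisor \<open>D'\<close> in its class with the least
  sum of squares; at least three of its values are 0, hence two zeros are on one side. An effective
  divisor in the class that is positive at both would be reached from \<open>D'\<close> by first firing a set that
  misses both (the set where the firing script is maximal). In degree at most 7 only single vertices
  and edges have a small enough cut for this, and firing such a set decreases the sum of squares.
\<close>

section \<open>Divisor classes described by the Laplacian\<close>

text \<open>In \<open>D - laplacian G f\<close> every vertex \<open>v\<close> has been fired
  \<open>f v\<close> times; negative values undo firings. Summing over vertices instead of arcs
  counts edges correctly because a \<open>graph\<close> has no parallel arcs.\<close>

definition laplacian :: "('a, 'b) pre_digraph \<Rightarrow> ('a \<Rightarrow> int) \<Rightarrow> 'a \<Rightarrow> int" where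
  "laplacian G f v = (\<Sum>w\<in>verts G. of_bool ((v, w) \<in> arcs_ends G) * (f v - f w))"

lemma laplacian_add: "laplacian G (\<lambda>u. f u + g u) v = laplacian G f v + laplacian G g v"
  by (simp add: laplacian_def flip: sum.distrib) (simp add: algebra_simps)

lemma laplacian_cmult: "laplacian G (\<lambda>u. c * f u) v = c * laplacian G f v"
  by (simp add: laplacian_def sum_distrib_left algebra_simps)

lemma laplacian_minus: "laplacian G (\<lambda>u. - f u) v = - laplacian G f v"
  using laplacian_cmult[of G "-1" f v] by simp

lemma laplacian_zero [simp]: "laplacian G (\<lambda>u. 0) v = 0"
  by (simp add: laplacian_def)

lemma laplacian_cong: "(\<And>u. u \<in> verts G \<Longrightarrow> f u = g u) \<Longrightarrow> v \<in> verts G \<Longrightarrow> laplacian G f v = laplacian G g v"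
  by (simp add: laplacian_def)

context graph
begin

lemma num_edges_eq: "num_edges G v w = of_bool ((v, w) \<in> arcs_ends G)"
proof (cases "(v, w) \<in> arcs_ends G")
  case True
  then obtain e where e: "e \<in> arcs G" "tail G e = v" "head G e = w"
    by (auto simp: arcs_ends_def arc_to_ends_def)
  have "{e \<in> arcs G. tail G e = v \<and> head G e = w} = {e}"
    using e no_multi_arcs by (fastforce simp: arc_to_ends_def)
  then show ?thesis using True by (simp add: num_edges_def)
next
  case False
  then have "{e \<in> arcs G. tail G e = v \<and> head G e = w} = {}"
    by (auto simp: arcs_ends_def arc_to_ends_def)
  then show ?thesis using False by (simp only: num_edges_def) simp
qed

lemma out_degree_eq: "int (out_degree G v) = (\<Sum>w\<in>verts G. of_bool ((v, w) \<in> arcs_ends G))"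
proof -
  have "out_degree G v = card (\<Union>w\<in>verts G. {e \<in> arcs G. tail G e = v \<and> head G e = w})"
    unfolding out_degree_def by (rule arg_cong[where f = card]) (auto simp: out_arcs_def)
  also have "\<dots> = (\<Sum>w\<in>verts G. num_edges G v w)"
    unfolding num_edges_def by (subst card_UN_disjoint) auto
  finally show ?thesis by (simp add: num_edges_eq)
qed

lemma not_adj_self: "(v, v) \<notin> arcs_ends G"
  using no_loops by (auto simp: arcs_ends_def arc_to_ends_def)

lemma adj_commute: "(v, w) \<in> arcs_ends G \<longleftrightarrow> (w, v) \<in> arcs_ends G"
  using graph_symmetric by blast

lemma fire_eq:
  assumes "v \<in> verts G"
  shows "fire G v D = (\<lambda>w. D w - laplacian G (\<lambda>u. of_bool (u = v)) w)"
proof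
  fix w
  show "fire G v D w = D w - laplacian G (\<lambda>u. of_bool (u = v)) w"
  proof (cases "w = v")
    case True
    have "laplacian G (\<lambda>u. of_bool (u = v)) v = int (out_degree G v)"
      unfolding laplacian_def out_degree_eq
      by (rule sum.cong) (auto simp: not_adj_self)
    then show ?thesis using True by (simp add: fire_def)
  next
    case False
    have "laplacian G (\<lambda>u. of_bool (u = v)) w
        = (\<Sum>u\<in>verts G. if u = v then - of_bool ((w, v) \<in> arcs_ends G) else 0)"
      unfolding laplacian_def using False by (intro sum.cong) auto
    also have "\<dots> = - int (num_edges G v w)"
      using assms adj_commute[of v w] by (simp add: num_edges_eq)
    finally show ?thesis using False by (simp add: fire_def)
  qed
qed

text \<open>The script counts firings along the chain of equivalences: a step along a firing of
  \<open>v\<close> adds one at \<open>v\<close>, a step against it subtracts one.\<close>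

lemma lin_equiv_laplacian_imp:
  assumes "lin_equiv G D D'"
  shows "\<exists>f. D' = (\<lambda>v. D v - laplacian G f v)"
  using assms unfolding lin_equiv_def
proof (induction rule: equivclp_induct)
  case base
  then show ?case by (intro exI[of _ "\<lambda>_. 0"]) simp
next
  case (step D1 D2)
  from step.IH obtain f where f: "D1 = (\<lambda>v. D v - laplacian G f v)" by blast
  from step.hyps(2) show ?case
  proof (elim disjE bexE)
    fix v assume "v \<in> verts G" "D2 = fire G v D1"
    then show ?thesis
      by (intro exI[of _ "\<lambda>u. f u + of_bool (u = v)"]) (simp add: f fire_eq laplacian_add diff_diff_eq)
  next
    fix v assume v: "v \<in> verts G" "D1 = fire G v D2"
    then have "D2 w = D1 w + laplacian G (\<lambda>u. of_bool (u = v)) w" for w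
      by (simp add: fire_eq)
    then show ?thesis
      by (intro exI[of _ "\<lambda>u. f u + (- of_bool (u = v))"] ext)
        (simp only: laplacian_add laplacian_minus, simp add: f)
  qed
qed

text \<open>Induction on \<open>c\<close> in both directions from 0. Downwards, the firing leads
  from the new divisor back to the old one, and symmetry of the closure turns it around.\<close>

lemma lin_equiv_laplacian_single:
  assumes "v \<in> verts G"
  shows "lin_equiv G D (\<lambda>w. D w - laplacian G (\<lambda>u. c * of_bool (u = v)) w)"
proof (induction c rule: int_induct[where k = 0])
  case base
  then show ?case by (simp add: lin_equiv_def)
next
  case (step1 i)
  let ?D = "\<lambda>w. D w - laplacian G (\<lambda>u. i * of_bool (u = v)) w"
  have "fire G v ?D = (\<lambda>w. D w - laplacian G (\<lambda>u. (i + 1) * of_bool (u = v)) w)"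
    using assms by (simp only: fire_eq laplacian_cmult) (simp add: algebra_simps)
  then have "lin_equiv G ?D (\<lambda>w. D w - laplacian G (\<lambda>u. (i + 1) * of_bool (u = v)) w)"
    unfolding lin_equiv_def using assms by (intro r_into_equivclp bexI[of _ v]) simp_all
  with step1.IH show ?case unfolding lin_equiv_def by (rule equivclp_trans)
next
  case (step2 i)
  let ?D = "\<lambda>w. D w - laplacian G (\<lambda>u. (i - 1) * of_bool (u = v)) w"
  have "fire G v ?D = (\<lambda>w. D w - laplacian G (\<lambda>u. i * of_bool (u = v)) w)"
    using assms by (simp only: fire_eq laplacian_cmult) (simp add: algebra_simps)
  then have "lin_equiv G ?D (\<lambda>w. D w - laplacian G (\<lambda>u. i * of_bool (u = v)) w)"
    unfolding lin_equiv_def using assms by (intro r_into_equivclp bexI[of _ v]) simp_all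
  then have "lin_equiv G (\<lambda>w. D w - laplacian G (\<lambda>u. i * of_bool (u = v)) w) ?D"
    unfolding lin_equiv_def by (rule equivclp_sym)
  with step2.IH show ?case unfolding lin_equiv_def by (rule equivclp_trans)
qed

lemma lin_equiv_laplacian: "lin_equiv G D (\<lambda>v. D v - laplacian G f v)"
proof -
  \<comment> \<open>The script is applied one vertex at a time: its restriction to \<open>A\<close>
    grows with \<open>A\<close>.\<close>
  have "finite A \<Longrightarrow> A \<subseteq> verts G \<Longrightarrow>
    lin_equiv G D (\<lambda>v. D v - laplacian G (\<lambda>u. if u \<in> A then f u else 0) v)" for A
  proof (induction A rule: finite_induct)
    case empty
    then show ?case by (simp add: lin_equiv_def)
  next
    case (insert a A)
    let ?D = "\<lambda>v. D v - laplacian G (\<lambda>u. if u \<in> A then f u else 0) v"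
    have "(\<lambda>u. if u \<in> insert a A then f u else 0)
        = (\<lambda>u. (if u \<in> A then f u else 0) + f a * of_bool (u = a))"
      using insert.hyps by auto
    then have eq: "(\<lambda>v. ?D v - laplacian G (\<lambda>u. f a * of_bool (u = a)) v)
        = (\<lambda>v. D v - laplacian G (\<lambda>u. if u \<in> insert a A then f u else 0) v)"
      by (simp only: laplacian_add) (simp add: algebra_simps)
    have "lin_equiv G D ?D" using insert by simp
    moreover have "lin_equiv G ?D (\<lambda>v. D v - laplacian G (\<lambda>u. if u \<in> insert a A then f u else 0) v)"
      unfolding eq[symmetric] using insert.prems by (intro lin_equiv_laplacian_single) auto
    ultimately show ?case unfolding lin_equiv_def by (rule equivclp_trans)
  qed
  from this[of "verts G"]
  have "lin_equiv G D (\<lambda>v. D v - laplacian G (\<lambda>u. if u \<in> verts G then f u else 0) v)" by simp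
  \<comment> \<open>The restriction alters \<open>f\<close> only outside the vertex set, where no
    arc ends.\<close>
  moreover have "laplacian G (\<lambda>u. if u \<in> verts G then f u else 0) v = laplacian G f v" for v
  proof (cases "v \<in> verts G")
    case False
    then have "(v, w) \<notin> arcs_ends G" for w by (auto dest: adj_in_verts)
    then show ?thesis by (simp add: laplacian_def)
  qed (auto intro: laplacian_cong)
  ultimately show ?thesis by simp
qed

lemma lin_equiv_iff: "lin_equiv G D D' \<longleftrightarrow> (\<exists>f. D' = (\<lambda>v. D v - laplacian G f v))"
proof
  show "lin_equiv G D D'" if "\<exists>f. D' = (\<lambda>v. D v - laplacian G f v)"
    using that lin_equiv_laplacian by (elim exE) simp
qed (rule lin_equiv_laplacian_imp)

section \<open>Degree, effectiveness and rank\<close>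

lemma laplacian_outside: "v \<notin> verts G \<Longrightarrow> laplacian G f v = 0"
  unfolding laplacian_def by (intro sum.neutral) (auto dest: adj_in_verts)

text \<open>Each edge contributes \<open>f v - f w\<close> at one end and \<open>f w - f v\<close>
  at the other. Hence linear equivalence preserves the degree.\<close>

lemma sum_laplacian: "(\<Sum>v\<in>verts G. laplacian G f v) = 0"
proof -
  let ?a = "\<lambda>v w. of_bool ((v, w) \<in> arcs_ends G) :: int"
  have "(\<Sum>v\<in>verts G. laplacian G f v)
      = (\<Sum>v\<in>verts G. \<Sum>w\<in>verts G. ?a v w * f v) - (\<Sum>v\<in>verts G. \<Sum>w\<in>verts G. ?a v w * f w)"
    by (simp add: laplacian_def right_diff_distrib sum_subtractf)
  also have "(\<Sum>v\<in>verts G. \<Sum>w\<in>verts G. ?a v w * f w) = (\<Sum>w\<in>verts G. \<Sum>v\<in>verts G. ?a v w * f w)"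
    by (rule sum.swap)
  also have "\<dots> = (\<Sum>v\<in>verts G. \<Sum>w\<in>verts G. ?a v w * f v)"
    by (intro sum.cong refl) (simp add: adj_commute)
  finally show ?thesis by simp
qed

lemma equiv_effective_iff:
  assumes "D \<in> divisors G"
  shows "equiv_effective G D \<longleftrightarrow> (\<exists>f. effective G (\<lambda>v. D v - laplacian G f v))"
proof -
  have "(\<lambda>v. D v - laplacian G f v) \<in> divisors G" for f
    using assms by (simp add: divisors_def laplacian_outside)
  then show ?thesis
    unfolding equiv_effective_def lin_equiv_iff by (metis (no_types, lifting))
qed

lemma equiv_effective_degree_nonneg:
  assumes "equiv_effective G D" "D \<in> divisors G"
  shows "0 \<le> div_degree G D"
proof -
  from assms(1) have "\<exists>f. effective G (\<lambda>v. D v - laplacian G f v)"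
    by (simp add: equiv_effective_iff[OF assms(2)])
  then obtain f where "effective G (\<lambda>v. D v - laplacian G f v)" ..
  then have "0 \<le> (\<Sum>v\<in>verts G. D v - laplacian G f v)"
    by (simp add: effective_def sum_nonneg)
  then show ?thesis by (simp add: sum_subtractf sum_laplacian div_degree_def)
qed

lemma equiv_effective_add:
  assumes "equiv_effective G D" "D \<in> divisors G" "E \<in> divisors G" "effective G E"
  shows "equiv_effective G (\<lambda>v. D v + E v)"
proof -
  have DE: "(\<lambda>v. D v + E v) \<in> divisors G" using assms by (simp add: divisors_def)
  from assms(1) have "\<exists>f. effective G (\<lambda>v. D v - laplacian G f v)"
    by (simp add: equiv_effective_iff[OF assms(2)])
  then obtain f where "effective G (\<lambda>v. D v - laplacian G f v)" ..
  then have "effective G (\<lambda>v. D v + E v - laplacian G f v)"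
    using assms(4) by (fastforce simp: effective_def)
  then show ?thesis unfolding equiv_effective_iff[OF DE] by (intro exI[of _ f])
qed

text \<open>Eliminates \<open>GREATEST\<close> and the default value -1. The condition is downward
  closed and bounded in \<open>k\<close>, and for 0 it says that \<open>D\<close> is equivalent to
  an effective divisor. Chips piled on \<open>q\<close> supply effective divisors of every
  degree.\<close>

lemma div_rank_ge_iff:
  assumes D: "D \<in> divisors G" and q: "q \<in> verts G"
  shows "int k \<le> div_rank G D \<longleftrightarrow>
    (\<forall>E\<in>divisors G. effective G E \<and> div_degree G E = int k \<longrightarrow> equiv_effective G (\<lambda>v. D v - E v))"
    (is "_ \<longleftrightarrow> ?P k")
proof -
  let ?q = "\<lambda>m::nat. \<lambda>v. int m * of_bool (v = q)"
  have q_div: "?q m \<in> divisors G" "effective G (?q m)" "div_degree G (?q m) = int m" for m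
    using q by (auto simp: divisors_def effective_def div_degree_def simp flip: sum_distrib_left)
  have sub: "(\<lambda>v. D v - E v) \<in> divisors G" if "E \<in> divisors G" for E
    using D that by (simp add: divisors_def)
  \<comment> \<open>Padding \<open>E\<close> with \<open>j - i\<close> chips at \<open>q\<close>
    reaches degree \<open>j\<close>; adding them back afterwards preserves equivalence to an
    effective divisor.\<close>
  have mono: "?P i" if "?P j" "i \<le> j" for i j
  proof (intro ballI impI, elim conjE)
    fix E assume E: "E \<in> divisors G" "effective G E" "div_degree G E = int i"
    let ?E = "\<lambda>v. E v + ?q (j - i) v"
    have E': "?E \<in> divisors G" "effective G ?E" "div_degree G ?E = int j"
      using E q_div[of "j - i"] \<open>i \<le> j\<close> by (auto simp: divisors_def effective_def div_degree_def sum.distrib)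
    then have "equiv_effective G (\<lambda>v. D v - ?E v)" using \<open>?P j\<close> by blast
    from equiv_effective_add[OF this sub[OF E'(1)] q_div(1,2)[of "j - i"]]
    show "equiv_effective G (\<lambda>v. D v - E v)" by simp
  qed
  \<comment> \<open>Removing \<open>m\<close> chips at \<open>q\<close> must leave a nonnegative
    degree.\<close>
  have bound: "m \<le> nat (div_degree G D)" if "?P m" for m
  proof -
    have "equiv_effective G (\<lambda>v. D v - ?q m v)" using that q_div[of m] by blast
    from equiv_effective_degree_nonneg[OF this sub[OF q_div(1)]]
    have "div_degree G (?q m) \<le> div_degree G D" by (simp add: div_degree_def sum_subtractf)
    then show ?thesis using q_div(3)[of m] by linarith
  qed
  have zero: "?P 0 \<longleftrightarrow> equiv_effective G D"
  proof
    assume "?P 0"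
    then show "equiv_effective G D" using q_div[of 0] by force
  next
    assume eff: "equiv_effective G D"
    show "?P 0"
    proof (intro ballI impI, elim conjE)
      fix E assume E: "E \<in> divisors G" "effective G E" "div_degree G E = int 0"
      then have "\<forall>v\<in>verts G. E v = 0"
        by (simp add: effective_def div_degree_def sum_nonneg_eq_0_iff)
      then have "E = (\<lambda>v. 0)" using E by (auto simp: divisors_def)
      then show "equiv_effective G (\<lambda>v. D v - E v)" using eff by simp
    qed
  qed
  show ?thesis
  proof (cases "equiv_effective G D")
    case True
    have G: "?P (GREATEST r. ?P r)"
      using zero True bound by (intro GreatestI_nat[where P = ?P and k = 0]) blast+
    have "k \<le> (GREATEST r. ?P r) \<longleftrightarrow> ?P k"
    proof
      assume "?P k"
      then show "k \<le> (GREATEST r. ?P r)" using bound by (intro Greatest_le_nat) blast+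
    qed (rule mono[OF G])
    then show ?thesis using True by (simp add: div_rank_def)
  next
    case False
    then have "\<not> ?P k" using mono[of k 0] zero by blast
    then show ?thesis using False by (simp add: div_rank_def)
  qed
qed

section \<open>Firing a set of maximal script value\<close>

text \<open>Firing only the set where \<open>f\<close> is maximal costs its vertices no more than
  the whole script: along each edge the integer drop \<open>f v - f w\<close> is 0 or at least
  1.\<close>

lemma laplacian_argmax:
  assumes "v \<in> verts G" "f v = m" "\<And>w. w \<in> verts G \<Longrightarrow> f w \<le> m"
  shows "laplacian G (\<lambda>w. of_bool (f w = m)) v \<le> laplacian G f v"
  unfolding laplacian_def
proof (rule sum_mono)
  fix w assume w: "w \<in> verts G"
  have "of_bool (f v = m) - of_bool (f w = m) \<le> f v - f w"
    using assms(2) assms(3)[OF w] by auto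
  then show "of_bool ((v, w) \<in> arcs_ends G) * (of_bool (f v = m) - of_bool (f w = m) :: int)
      \<le> of_bool ((v, w) \<in> arcs_ends G) * (f v - f w)"
    by (rule mult_left_mono) simp
qed

lemma laplacian_argmax_nonneg:
  assumes "v \<in> verts G" "\<And>w. w \<in> verts G \<Longrightarrow> f w \<le> f v"
  shows "0 \<le> laplacian G f v"
  unfolding laplacian_def using assms by (intro sum_nonneg mult_nonneg_nonneg) auto

end

text \<open>Here \<open>c\<close> is what firing \<open>U\<close> removes. The squares change by at
  most \<open>- 3 * c v\<close> on \<open>U\<close> and by at most \<open>2 * D v - c v\<close>
  elsewhere. As \<open>c\<close> sums to 0, the total is at most twice
  \<open>sum D (V - U) - sum c U\<close>. This is negative, because \<open>sum D U\<close> and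
  \<open>sum c U\<close> are both at least 4 and \<open>sum D V\<close> is at most 7.\<close>

lemma sum_squares_firing_decrease:
  fixes D c :: "'a \<Rightarrow> int"
  assumes fin: "finite V" and U: "U \<subseteq> V"
    and D: "\<And>v. v \<in> V \<Longrightarrow> 0 \<le> D v" "sum D V \<le> 7"
    and c: "sum c V = 0" "\<And>v. v \<in> U \<Longrightarrow> 3 \<le> c v" "\<And>v. v \<in> U \<Longrightarrow> c v \<le> D v"
      "\<And>v. v \<in> V - U \<Longrightarrow> c v = 0 \<or> c v = -1" "4 \<le> sum c U"
  shows "(\<Sum>v\<in>V. (D v - c v)\<^sup>2) < (\<Sum>v\<in>V. (D v)\<^sup>2)"
proof -
  have split: "sum g V = sum g U + sum g (V - U)" for g :: "'a \<Rightarrow> int"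
    using sum.subset_diff[OF U fin, of g] by simp
  have "(\<Sum>v\<in>U. (D v - c v)\<^sup>2 - (D v)\<^sup>2) \<le> (\<Sum>v\<in>U. - 3 * c v)"
  proof (rule sum_mono)
    fix v assume v: "v \<in> U"
    have "(D v - c v)\<^sup>2 - (D v)\<^sup>2 = - (c v * c v) - 2 * (c v * (D v - c v))"
      by (simp add: power2_eq_square algebra_simps)
    moreover have "3 * c v \<le> c v * c v" using c(2)[OF v] by (intro mult_right_mono) auto
    moreover have "0 \<le> c v * (D v - c v)" using c(2,3)[OF v] by (intro mult_nonneg_nonneg) auto
    ultimately show "(D v - c v)\<^sup>2 - (D v)\<^sup>2 \<le> - 3 * c v" by linarith
  qed
  moreover have "(\<Sum>v\<in>V - U. (D v - c v)\<^sup>2 - (D v)\<^sup>2) \<le> (\<Sum>v\<in>V - U. 2 * D v - c v)"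
  proof (rule sum_mono)
    fix v assume v: "v \<in> V - U"
    then have "0 \<le> D v" using D by auto
    with c(4)[OF v] show "(D v - c v)\<^sup>2 - (D v)\<^sup>2 \<le> 2 * D v - c v"
      by (auto simp: power2_eq_square algebra_simps)
  qed
  moreover have "sum c U \<le> sum D U" using c(3) by (rule sum_mono)
  ultimately have "(\<Sum>v\<in>V. (D v - c v)\<^sup>2 - (D v)\<^sup>2) < 0"
    using split[of D] split[of c] split[of "\<lambda>v. (D v - c v)\<^sup>2 - (D v)\<^sup>2"] c(1,5) D(2)
    by (simp add: sum_subtractf sum_negf flip: sum_distrib_left)
  then show ?thesis by (simp add: sum_subtractf)
qed

section \<open>Laplacian and cuts of crown graphs\<close>

lemma verts_crown_graph: "verts (crown_graph n) = Inl ` {..<n} \<union> Inr ` {..<n}"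
  by (simp add: crown_graph_defs)

lemma sum_verts_crown_graph:
  "sum g (verts (crown_graph n)) = (\<Sum>i<n. g (Inl i)) + (\<Sum>i<n. g (Inr i))"
  unfolding verts_crown_graph by (subst sum.union_disjoint) (auto simp: sum.reindex)

lemma adj_crown_graph [simp]:
  "(Inl i, Inr j) \<in> arcs_ends (crown_graph n) \<longleftrightarrow> i < n \<and> j < n \<and> i \<noteq> j"
  "(Inr i, Inl j) \<in> arcs_ends (crown_graph n) \<longleftrightarrow> i < n \<and> j < n \<and> i \<noteq> j"
  "(Inl i, Inl j) \<notin> arcs_ends (crown_graph n)"
  "(Inr i, Inr j) \<notin> arcs_ends (crown_graph n)"
  by (auto simp: arcs_ends_crown_graph)

lemma laplacian_crown_graph:
  assumes "i < n"
  shows "laplacian (crown_graph n) f (Inl i) = (\<Sum>j\<in>{..<n} - {i}. f (Inl i) - f (Inr j))"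
    and "laplacian (crown_graph n) f (Inr i) = (\<Sum>j\<in>{..<n} - {i}. f (Inr i) - f (Inl j))"
  unfolding laplacian_def sum_verts_crown_graph using assms
  by (auto intro!: sum.mono_neutral_cong_right)

lemma sum_of_bool_diff:
  assumes "i < n" "S \<subseteq> {..<n}"
  shows "(\<Sum>j\<in>{..<n} - {i}. of_bool b - of_bool (j \<in> S)) = (int n - 1) * of_bool b - int (card (S - {i}))"
proof -
  have "({..<n} - {i}) \<inter> S = S - {i}" using assms by auto
  then show ?thesis using assms by (simp add: sum_subtractf sum.If_cases of_bool_def)
qed

context
  fixes n :: nat and U :: "(nat + nat) set" and L R :: "nat set"
  assumes L: "L \<subseteq> {..<n}" and R: "R \<subseteq> {..<n}" and U_eq: "U = Inl ` L \<union> Inr ` R"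
begin

lemma laplacian_indicator_crown_graph:
  assumes "i < n"
  shows "laplacian (crown_graph n) (\<lambda>v. of_bool (v \<in> U)) (Inl i)
      = (int n - 1) * of_bool (i \<in> L) - int (card (R - {i}))"
    and "laplacian (crown_graph n) (\<lambda>v. of_bool (v \<in> U)) (Inr i)
      = (int n - 1) * of_bool (i \<in> R) - int (card (L - {i}))"
proof -
  have *: "Inl j \<in> U \<longleftrightarrow> j \<in> L" "Inr j \<in> U \<longleftrightarrow> j \<in> R" for j using U_eq by auto
  show "laplacian (crown_graph n) (\<lambda>v. of_bool (v \<in> U)) (Inl i)
      = (int n - 1) * of_bool (i \<in> L) - int (card (R - {i}))"
   "laplacian (crown_graph n) (\<lambda>v. of_bool (v \<in> U)) (Inr i)
      = (int n - 1) * of_bool (i \<in> R) - int (card (L - {i}))"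
    by (simp_all only: laplacian_crown_graph[OF assms] * sum_of_bool_diff[OF assms L] sum_of_bool_diff[OF assms R])
qed

text \<open>The left side counts the edges leaving \<open>U\<close>: the valences sum to
  \<open>n - 1\<close> times the size of \<open>U\<close>, and each of the
  \<open>card L * card R - card (L \<inter> R)\<close> inner edges is subtracted twice.\<close>

lemma cut_crown_graph:
  "(\<Sum>v\<in>U. laplacian (crown_graph n) (\<lambda>v. of_bool (v \<in> U)) v)
    = (int n - 1) * (int (card L) + int (card R)) - 2 * int (card L) * int (card R)
      + 2 * int (card (L \<inter> R))"
proof -
  have fin: "finite L" "finite R" using L R finite_subset by blast+
  have half: "(\<Sum>i\<in>A. (int n - 1) * of_bool (i \<in> A) - int (card (B - {i})))
      = (int n - 1) * int (card A) - int (card A) * int (card B) + int (card (A \<inter> B))"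
    if "finite A" "finite B" for A B :: "nat set"
  proof -
    have "(int n - 1) * of_bool (i \<in> A) - int (card (B - {i}))
        = (int n - 1 - int (card B)) + of_bool (i \<in> B)" if "i \<in> A" for i
    proof (cases "i \<in> B")
      case True
      then have "0 < card B" using \<open>finite B\<close> card_gt_0_iff by blast
      then show ?thesis using True that by simp
    qed (use that in simp)
    then have "(\<Sum>i\<in>A. (int n - 1) * of_bool (i \<in> A) - int (card (B - {i})))
        = (\<Sum>i\<in>A. (int n - 1 - int (card B)) + of_bool (i \<in> B))"
      by (rule sum.cong[OF refl])
    also have "\<dots> = (int n - 1) * int (card A) - int (card A) * int (card B) + int (card (A \<inter> B))"
      using that by (subst sum.distrib) (simp add: algebra_simps Int_def)
    finally show ?thesis .
  qed
  let ?c = "laplacian (crown_graph n) (\<lambda>v. of_bool (v \<in> U))"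
  have "(\<Sum>v\<in>U. ?c v) = (\<Sum>i\<in>L. ?c (Inl i)) + (\<Sum>i\<in>R. ?c (Inr i))"
    using fin by (simp add: U_eq) (subst sum.union_disjoint; auto simp: sum.reindex)
  also have "(\<Sum>i\<in>L. ?c (Inl i)) = (\<Sum>i\<in>L. (int n - 1) * of_bool (i \<in> L) - int (card (R - {i})))"
    using L by (intro sum.cong refl laplacian_indicator_crown_graph) auto
  also have "(\<Sum>i\<in>R. ?c (Inr i)) = (\<Sum>i\<in>R. (int n - 1) * of_bool (i \<in> R) - int (card (L - {i})))"
    using R by (intro sum.cong refl laplacian_indicator_crown_graph) auto
  finally show ?thesis unfolding half[OF fin] half[OF fin(2) fin(1)]
    by (simp add: algebra_simps Int_commute)
qed

end

section \<open>Lower bound: degree at most 7 does not give rank 2\<close>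

text \<open>With \<open>a\<close>, \<open>b\<close>, \<open>m\<close> the sizes of \<open>L\<close>,
  \<open>R\<close>, \<open>L \<inter> R\<close>, this bounds the sets with cut at most 7 for
  \<open>n = 5\<close>. The third assumption rules out complements of such small sets, which have
  the same cut; the fourth forces enough matched pairs in sets of sizes such as 3 and 3.\<close>

lemma small_cut_arith:
  fixes a b m :: nat
  assumes "a \<le> 5" "b \<le> 5" "a \<le> 3 \<or> b \<le> 3" "a + b \<le> 5 + m"
    and "4 * (int a + int b) - 2 * int a * int b + 2 * int m \<le> 7"
  shows "a \<le> 1 \<and> b \<le> 1"
proof -
  have "a \<in> {0,1,2,3,4,5}" "b \<in> {0,1,2,3,4,5}" using assms(1,2) by auto
  then show ?thesis using assms(3-5) by auto
qed


text \<open>One side carries at most 3 chips, so at least two of its five vertices are empty. The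
  constructor \<open>s\<close> names that side, which lets both sides be treated alike.\<close>

lemma two_zeros_same_side:
  fixes D :: "nat + nat \<Rightarrow> int"
  assumes "\<And>i. i < 5 \<Longrightarrow> 0 \<le> D (Inl i)" "\<And>i. i < 5 \<Longrightarrow> 0 \<le> D (Inr i)"
    and "(\<Sum>i<5. D (Inl i)) + (\<Sum>i<5. D (Inr i)) \<le> 7"
  obtains s i j where "s = Inl \<or> s = Inr" "i < 5" "j < 5" "i \<noteq> j" "D (s i) = 0" "D (s j) = 0"
proof -
  have side: "\<exists>i<5. \<exists>j<5. i \<noteq> j \<and> g i = 0 \<and> g j = 0"
    if g: "\<And>i. i < 5 \<Longrightarrow> 0 \<le> g i" "(\<Sum>i<5. g i) \<le> 3" for g :: "nat \<Rightarrow> int"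
  proof (rule ccontr)
    assume no: "\<not> ?thesis"
    let ?Z = "{i \<in> {..<5::nat}. g i = 0}"
    have "card ?Z \<le> 1" using no by (intro card_le_Suc0_iff_eq[THEN iffD2, simplified One_nat_def[symmetric]]) auto
    then have "4 \<le> int (card ({..<5} - ?Z))" by (subst card_Diff_subset) auto
    also have "\<dots> = (\<Sum>i\<in>{..<5} - ?Z. 1)" by simp
    also have "\<dots> \<le> (\<Sum>i\<in>{..<5} - ?Z. g i)"
      using g(1) by (intro sum_mono) (force simp: order_le_less)
    also have "\<dots> \<le> (\<Sum>i<5. g i)" using g(1) by (intro sum_mono2) auto
    finally show False using g(2) by simp
  qed
  have "(\<Sum>i<5. D (Inl i)) \<le> 3 \<or> (\<Sum>i<5. D (Inr i)) \<le> 3" using assms(3) by linarith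
  then show thesis
  proof
    assume "(\<Sum>i<5. D (Inl i)) \<le> 3"
    from side[of "\<lambda>i. D (Inl i)", OF assms(1) this] that[of Inl] show thesis by blast
  next
    assume "(\<Sum>i<5. D (Inr i)) \<le> 3"
    from side[of "\<lambda>i. D (Inr i)", OF assms(2) this] that[of Inr] show thesis by blast
  qed
qed

lemma divisor_indicator:
  assumes "p \<in> verts G" "q \<in> verts G" "finite (verts G)"
  shows "(\<lambda>v. of_bool (v = p) + of_bool (v = q)) \<in> divisors G"
    "effective G (\<lambda>v. of_bool (v = p) + of_bool (v = q))"
    "div_degree G (\<lambda>v. of_bool (v = p) + of_bool (v = q)) = 2"
  using assms by (auto simp: divisors_def effective_def div_degree_def sum.distrib of_bool_def)

lemma degree_ge_8_if_rank_ge_2: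
  assumes D: "D \<in> divisors (crown_graph 5)" and rank: "2 \<le> div_rank (crown_graph 5) D"
  shows "8 \<le> div_degree (crown_graph 5) D"
proof (rule ccontr)
  let ?G = "crown_graph 5"
  interpret graph ?G by (rule crown_graph)
  let ?lap = "laplacian ?G" and ?V = "verts ?G"
  assume "\<not> ?thesis"
  then have deg: "sum D ?V \<le> 7" by (simp add: div_degree_def)
  have rank: "equiv_effective ?G (\<lambda>v. D v - E v)"
    if "E \<in> divisors ?G" "effective ?G E" "div_degree ?G E = 2" for E
  proof -
    have "Inl 0 \<in> ?V" by (simp add: verts_crown_graph)
    from div_rank_ge_iff[OF D this, of 2] rank that show ?thesis by auto
  qed
  \<comment> \<open>Minimising over scripts instead of divisors keeps the minimiser in the class of
    \<open>D\<close>; \<open>nat\<close> makes the values well ordered.\<close>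
  let ?sq = "\<lambda>f. nat (\<Sum>v\<in>?V. (D v - ?lap f v)\<^sup>2)"
  have "equiv_effective ?G D" using rank assms(2) by (auto simp: div_rank_def split: if_splits)
  then have "\<exists>f. effective ?G (\<lambda>v. D v - ?lap f v)" by (simp add: equiv_effective_iff[OF D])
  then obtain f1 where "effective ?G (\<lambda>v. D v - ?lap f1 v)" ..
  from ex_has_least_nat[where P = "\<lambda>f. effective ?G (\<lambda>v. D v - ?lap f v)" and m = ?sq, OF this]
  obtain f0 where f0: "effective ?G (\<lambda>v. D v - ?lap f0 v)"
    and least: "\<And>f. effective ?G (\<lambda>v. D v - ?lap f v) \<Longrightarrow> ?sq f0 \<le> ?sq f"
    by auto
  define D' where "D' v = D v - ?lap f0 v" for v
  have D'_nonneg: "0 \<le> D' v" if "v \<in> ?V" for v using f0 that by (simp add: effective_def D'_def)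
  have D'_deg: "sum D' ?V \<le> 7" using deg by (simp add: D'_def sum_subtractf sum_laplacian)
  obtain s i j where s: "s = Inl \<or> s = Inr" and ij: "i < 5" "j < 5" "i \<noteq> j"
    and zero: "D' (s i) = 0" "D' (s j) = 0"
  proof (rule two_zeros_same_side[of D'])
    show "(\<Sum>i<5. D' (Inl i)) + (\<Sum>i<5. D' (Inr i)) \<le> 7"
      using D'_deg by (simp add: sum_verts_crown_graph)
  qed (auto intro: D'_nonneg simp: verts_crown_graph)
  \<comment> \<open>The rank is tested with one chip at each of the two zeros of
    \<open>D'\<close>.\<close>
  define E :: "nat + nat \<Rightarrow> int" where "E = (\<lambda>v. of_bool (v = s i) + of_bool (v = s j))"
  have sV: "s i \<in> ?V" "s j \<in> ?V" using s ij by (auto simp: verts_crown_graph)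
  note E = divisor_indicator[OF sV finite_verts, folded E_def]
  have "(\<lambda>v. D v - E v) \<in> divisors ?G" using D E(1) by (simp add: divisors_def)
  from equiv_effective_iff[OF this] rank[OF E]
  obtain g where g: "effective ?G (\<lambda>v. D v - E v - ?lap g v)" by auto
  \<comment> \<open>Since \<open>D' - ?lap f = D - ?lap g\<close>, the script \<open>f\<close> leads
    from \<open>D'\<close> to an effective divisor that dominates \<open>E\<close>.\<close>
  define f where "f v = g v + - f0 v" for v
  have lap_f: "?lap f v = ?lap g v - ?lap f0 v" for v
    unfolding f_def by (simp only: laplacian_add laplacian_minus)
  have f_le: "?lap f v \<le> D' v - E v" if "v \<in> ?V" for v
    using g that by (auto simp: effective_def D'_def lap_f algebra_simps)
  define M where "M = Max (f ` ?V)"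
  have M_ge: "f v \<le> M" if "v \<in> ?V" for v using that by (simp add: M_def)
  define U where "U = {v \<in> ?V. f v = M}"
  have "M \<in> f ` ?V" unfolding M_def using sV by (intro Max_in) auto
  then have "U \<noteq> {}" by (auto simp: U_def)
  let ?c = "?lap (\<lambda>v. of_bool (v \<in> U))"
  have c_eq: "?c v = ?lap (\<lambda>v. of_bool (f v = M)) v" if "v \<in> ?V" for v
    using that by (intro laplacian_cong) (auto simp: U_def)
  have E_nonneg: "0 \<le> E v" for v by (simp add: E_def)
  have c_le: "?c v \<le> D' v" if "v \<in> U" for v
  proof -
    have v: "v \<in> ?V" "f v = M" using that by (auto simp: U_def)
    have "?c v \<le> ?lap f v" unfolding c_eq[OF v(1)] by (rule laplacian_argmax[where f = f, OF v M_ge])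
    then show ?thesis using f_le[OF v(1)] E_nonneg[of v] by linarith
  qed
  \<comment> \<open>At a vertex of \<open>U\<close> the script \<open>f\<close> never brings in
    chips, whereas \<open>s i\<close> and \<open>s j\<close> start with none and must receive
    one.\<close>
  have not_U: "s i \<notin> U" "s j \<notin> U"
  proof -
    have "v \<notin> U" if "v \<in> ?V" "D' v = 0" "0 < E v" for v
    proof
      assume "v \<in> U"
      then have "0 \<le> ?lap f v" using that M_ge by (intro laplacian_argmax_nonneg) (auto simp: U_def)
      then show False using f_le[of v] that by simp
    qed
    then show "s i \<notin> U" "s j \<notin> U" using sV zero by (auto simp: E_def)
  qed
  define L R where "L = {i. Inl i \<in> U}" and "R = {i. Inr i \<in> U}"
  have LR: "L \<subseteq> {..<5}" "R \<subseteq> {..<5}" by (auto simp: L_def R_def U_def verts_crown_graph)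
  have U_eq: "U = Inl ` L \<union> Inr ` R"
    unfolding L_def R_def using sum.exhaust by (auto simp: image_iff) (metis sum.exhaust)
  have fin: "finite L" "finite R" using LR finite_subset by blast+
  note c_ind = laplacian_indicator_crown_graph[OF LR U_eq]
  note cut = cut_crown_graph[OF LR U_eq]
  have "U \<subseteq> ?V" by (auto simp: U_def)
  have "sum ?c U \<le> sum D' U" using c_le by (rule sum_mono)
  also have "\<dots> \<le> sum D' ?V" using \<open>U \<subseteq> ?V\<close> D'_nonneg by (intro sum_mono2) auto
  finally have cut_le: "sum ?c U \<le> 7" using D'_deg by simp
  have card_le: "card S \<le> 5" if "S \<subseteq> {..<5}" for S :: "nat set"
    using card_mono[OF _ that] by simp
  have "card L + card R \<le> 5 + card (L \<inter> R)"
    using card_Un_Int[OF fin] card_le[of "L \<union> R"] LR by simp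
  \<comment> \<open>\<open>U\<close> misses two of the five vertices on the side
    \<open>s\<close>.\<close>
  moreover have "card L \<le> 3 \<or> card R \<le> 3"
  proof -
    have "card S \<le> 3" if "S \<subseteq> {..<5}" "i \<notin> S" "j \<notin> S" for S
    proof -
      have "S \<subseteq> {..<5} - {i, j}" using that by auto
      then have "card S \<le> card ({..<5} - {i, j})" by (intro card_mono) auto
      then show ?thesis using ij by (simp add: card_Diff_subset)
    qed
    then show ?thesis using s not_U LR by (auto simp: L_def R_def)
  qed
  ultimately have small: "card L \<le> 1" "card R \<le> 1"
    using small_cut_arith[of "card L" "card R" "card (L \<inter> R)"] card_le LR cut_le
    unfolding cut by auto
  have nonempty: "1 \<le> card L + card R"
    using \<open>U \<noteq> {}\<close> fin unfolding U_eq by (cases "L = {}") (auto simp: Suc_le_eq card_gt_0_iff)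
  have le1: "card (S - {k}) \<le> 1" if "card S \<le> 1" for S :: "nat set" and k
    using card_Diff1_le[of S k] that by linarith
  have U_iff: "Inl k \<in> U \<longleftrightarrow> k \<in> L" "Inr k \<in> U \<longleftrightarrow> k \<in> R" for k by (simp_all add: L_def R_def)
  \<comment> \<open>A vertex of \<open>U\<close> has valence 4 and at most one neighbour in
    \<open>U\<close>.\<close>
  have c_U: "3 \<le> ?c v" if "v \<in> U" for v
  proof (cases v)
    case (Inl k)
    then have "k \<in> L" "k < 5" using that LR by (auto simp: U_iff)
    then show ?thesis using Inl le1[OF small(2), of k] by (simp only: c_ind) simp
  next
    case (Inr k)
    then have "k \<in> R" "k < 5" using that LR by (auto simp: U_iff)
    then show ?thesis using Inr le1[OF small(1), of k] by (simp only: c_ind) simp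
  qed
  \<comment> \<open>A vertex outside \<open>U\<close> gains one chip per neighbour in
    \<open>U\<close>, and \<open>U\<close> has at most one vertex on the opposite side.\<close>
  have c_not_U: "?c v = 0 \<or> ?c v = -1" if "v \<in> ?V - U" for v
  proof (cases v)
    case (Inl k)
    then have "k \<notin> L" "k < 5" using that by (auto simp: U_iff verts_crown_graph)
    then show ?thesis using Inl le1[OF small(2), of k] by (simp only: c_ind) (auto simp: le_Suc_eq)
  next
    case (Inr k)
    then have "k \<notin> R" "k < 5" using that by (auto simp: U_iff verts_crown_graph)
    then show ?thesis using Inr le1[OF small(1), of k] by (simp only: c_ind) (auto simp: le_Suc_eq)
  qed
  have "card L \<in> {0, 1}" "card R \<in> {0, 1}" using small by auto
  \<comment> \<open>A single vertex has cut 4; one vertex on each side gives 6, or 8 if they are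
    matched.\<close>
  then have "4 \<le> sum ?c U" unfolding cut using nonempty by auto
  then have less: "(\<Sum>v\<in>?V. (D' v - ?c v)\<^sup>2) < (\<Sum>v\<in>?V. (D' v)\<^sup>2)"
    by (intro sum_squares_firing_decrease[where U = U])
      (use \<open>U \<subseteq> ?V\<close> D'_nonneg D'_deg sum_laplacian c_U c_le c_not_U in auto)
  \<comment> \<open>Firing \<open>U\<close> after \<open>f0\<close> is again a script for
    \<open>D\<close>, so it competes with the minimiser \<open>f0\<close>.\<close>
  have D'c: "(\<lambda>v. D' v - ?c v) = (\<lambda>v. D v - ?lap (\<lambda>u. f0 u + of_bool (u \<in> U)) v)"
    by (simp add: D'_def laplacian_add diff_diff_eq)
  have "0 \<le> D' v - ?c v" if "v \<in> ?V" for v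
    using c_le[of v] c_not_U[of v] D'_nonneg[OF that] that by (cases "v \<in> U") auto
  then have "effective ?G (\<lambda>v. D' v - ?c v)" by (simp add: effective_def)
  then have "?sq f0 \<le> ?sq (\<lambda>u. f0 u + of_bool (u \<in> U))" unfolding D'c by (rule least)
  then have "nat (\<Sum>v\<in>?V. (D' v)\<^sup>2) \<le> nat (\<Sum>v\<in>?V. (D' v - ?c v)\<^sup>2)"
    unfolding fun_cong[OF D'c] unfolding D'_def .
  moreover have "0 \<le> (\<Sum>v\<in>?V. (D' v - ?c v)\<^sup>2)" by (simp add: sum_nonneg)
  ultimately show False using less by linarith
qed

section \<open>Upper bound: a divisor of degree 8 and rank at least 2\<close>

text \<open>A chip is taken off a vertex of positive value twice; what remains is nonnegative of
  degree 0.\<close>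

lemma divisor_degree_2_eq:
  assumes fin: "finite (verts G)" and E: "E \<in> divisors G" "effective G E" "div_degree G E = 2"
  obtains p q where "p \<in> verts G" "q \<in> verts G" "E = (\<lambda>v. of_bool (v = p) + of_bool (v = q))"
proof -
  have pos: "\<exists>p\<in>verts G. 0 < F p" if "0 < sum F (verts G)" for F :: "'a \<Rightarrow> int"
    using that sum_nonpos[of "verts G" F] by (meson not_le)
  have "0 < sum E (verts G)" using E(3) by (simp add: div_degree_def)
  from pos[OF this] obtain p where p: "p \<in> verts G" "0 < E p" by blast
  have "sum (\<lambda>v. E v - of_bool (v = p)) (verts G) = 1"
    using E(3) fin p by (simp add: div_degree_def sum_subtractf of_bool_def)
  with pos[of "\<lambda>v. E v - of_bool (v = p)"] obtain q where q: "q \<in> verts G" "0 < E q - of_bool (q = p)"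
    by auto
  let ?F = "\<lambda>v. E v - of_bool (v = p) - of_bool (v = q)"
  have "sum ?F (verts G) = 0"
    using E(3) fin p q by (simp add: div_degree_def sum_subtractf of_bool_def)
  moreover have "0 \<le> ?F v" if "v \<in> verts G" for v
    using E(2) p q that by (cases "v = p"; cases "v = q") (auto simp: effective_def)
  ultimately have "?F v = 0" if "v \<in> verts G" for v
    using that sum_nonneg_eq_0_iff[OF fin, of ?F] by blast
  then have "E v = of_bool (v = p) + of_bool (v = q)" for v
    using E(1) p(1) q(1) by (cases "v \<in> verts G") (force simp: divisors_def algebra_simps)+
  then have "E = (\<lambda>v. of_bool (v = p) + of_bool (v = q))" by auto
  with p q that show thesis by blast
qed

lemma card_singleton_Diff: "card ({x} - {i}) = of_bool (x \<noteq> i)"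
  by (auto simp: insert_Diff_if)

text \<open>
  The sets \<open>L\<close> and \<open>R\<close> are the two halves of the set that is fired backwards from the divisor with
  one chip on all vertices except \<open>Inl 0\<close> and \<open>Inr 0\<close>, so as to dominate the chips at \<open>p\<close> and \<open>q\<close>.
\<close>

lemma degree_8_covers:
  assumes "p \<in> verts (crown_graph 5)" "q \<in> verts (crown_graph 5)"
  shows "\<exists>L\<subseteq>{..<5}. \<exists>R\<subseteq>{..<5}. \<forall>i<5.
      of_bool (Inl i = p) + of_bool (Inl i = q)
        \<le> of_bool (i \<noteq> 0) + 4 * of_bool (i \<in> L) - int (card (R - {i})) \<and>
      of_bool (Inr i = p) + of_bool (Inr i = q)
        \<le> of_bool (i \<noteq> 0) + 4 * of_bool (i \<in> R) - int (card (L - {i}))"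
    (is "\<exists>L\<subseteq>_. \<exists>R\<subseteq>_. ?P L R")
proof -
  have P: ?thesis if "L \<subseteq> {..<5}" "R \<subseteq> {..<5}" "?P L R" for L R using that by blast
  \<comment> \<open>The neighbours of \<open>Inl 0\<close> are exactly the \<open>Inr\<close>
    vertices that carry a chip, so firing \<open>Inl 0\<close> backwards creates no debt; likewise
    for \<open>Inr 0\<close>. For two chips at \<open>Inl a\<close>, firing \<open>Inl a\<close>
    backwards alone would put \<open>Inr 0\<close> into debt, so \<open>Inr 0\<close> joins. For
    \<open>Inl 0\<close> with \<open>Inr a\<close>, firing \<open>Inl 0\<close> backwards alone
    would take the chip needed at \<open>Inr a\<close>, so \<open>Inr a\<close> joins. The other
    side is symmetric, and in the last case the divisor already suffices.\<close>
  consider a where "a < 5" "a \<noteq> 0" "p = Inl a" "q = Inl a"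
    | a where "a < 5" "a \<noteq> 0" "p = Inr a" "q = Inr a"
    | a where "a < 5" "a \<noteq> 0" "p = Inl 0 \<and> q = Inr a \<or> q = Inl 0 \<and> p = Inr a"
    | a where "a < 5" "a \<noteq> 0" "p = Inr 0 \<and> q = Inl a \<or> q = Inr 0 \<and> p = Inl a"
    | a where "a < 5" "p = Inl 0 \<and> q = Inl a \<or> q = Inl 0 \<and> p = Inl a"
    | a where "a < 5" "p = Inr 0 \<and> q = Inr a \<or> q = Inr 0 \<and> p = Inr a"
    | "p = Inl 0 \<and> q = Inr 0 \<or> q = Inl 0 \<and> p = Inr 0"
    | "p \<noteq> q" "p \<noteq> Inl 0" "p \<noteq> Inr 0" "q \<noteq> Inl 0" "q \<noteq> Inr 0"
    using assms unfolding verts_crown_graph by (cases p; cases q) auto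
  then show ?thesis
  proof cases
    case 1 then show ?thesis by (intro P[of "{a}" "{0}"]) (auto simp: card_singleton_Diff)
  next
    case 2 then show ?thesis by (intro P[of "{0}" "{a}"]) (auto simp: card_singleton_Diff)
  next
    case 3 then show ?thesis by (intro P[of "{0}" "{a}"]) (auto simp: card_singleton_Diff)
  next
    case 4 then show ?thesis by (intro P[of "{a}" "{0}"]) (auto simp: card_singleton_Diff)
  next
    case 5 then show ?thesis by (intro P[of "{0}" "{}"]) (auto simp: card_singleton_Diff)
  next
    case 6 then show ?thesis by (intro P[of "{}" "{0}"]) (auto simp: card_singleton_Diff)
  next
    case 7 then show ?thesis by (intro P[of "{0}" "{0}"]) (auto simp: card_singleton_Diff)
  next
    case 8 then show ?thesis by (intro P[of "{}" "{}"]) (auto simp: card_singleton_Diff)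
  qed
qed

lemma degree_8_rank_ge_2:
  "\<exists>D\<in>divisors (crown_graph 5). 2 \<le> div_rank (crown_graph 5) D \<and> div_degree (crown_graph 5) D = 8"
proof (intro bexI conjI)
  let ?G = "crown_graph 5"
  interpret graph ?G by (rule crown_graph)
  define D :: "nat + nat \<Rightarrow> int"
    where "D v = of_bool (v \<in> verts ?G \<and> v \<noteq> Inl 0 \<and> v \<noteq> Inr 0)" for v
  show D: "D \<in> divisors ?G" by (simp add: divisors_def D_def)
  have D_eq: "D (Inl i) = of_bool (i \<noteq> 0)" "D (Inr i) = of_bool (i \<noteq> 0)" if "i < 5" for i
    using that by (auto simp: D_def verts_crown_graph)
  have "(\<Sum>i<5::nat. of_bool (i \<noteq> 0)) = (4 :: int)" by (simp add: eval_nat_numeral)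
  then show "div_degree ?G D = 8"
    unfolding div_degree_def sum_verts_crown_graph by (simp add: D_eq cong: sum.cong_simp)
  have "equiv_effective ?G (\<lambda>v. D v - E v)"
    if E: "E \<in> divisors ?G" "effective ?G E" "div_degree ?G E = 2" for E
  proof -
    obtain p q where pq: "p \<in> verts ?G" "q \<in> verts ?G"
      and E_eq: "E = (\<lambda>v. of_bool (v = p) + of_bool (v = q))"
      using divisor_degree_2_eq[OF finite_verts E] by blast
    obtain L R where LR: "L \<subseteq> {..<5}" "R \<subseteq> {..<5}"
      and le: "\<And>i. i < 5 \<Longrightarrow> E (Inl i) \<le> D (Inl i) + 4 * of_bool (i \<in> L) - int (card (R - {i}))"
        "\<And>i. i < 5 \<Longrightarrow> E (Inr i) \<le> D (Inr i) + 4 * of_bool (i \<in> R) - int (card (L - {i}))"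
      using degree_8_covers[OF pq] unfolding E_eq by (auto simp: D_eq)
    let ?U = "Inl ` L \<union> Inr ` R"
    note c = laplacian_indicator_crown_graph[OF LR refl]
    have "0 \<le> D v - E v + laplacian ?G (\<lambda>v. of_bool (v \<in> ?U)) v" if "v \<in> verts ?G" for v
    proof (cases v)
      case (Inl i)
      then have "i < 5" using that by (auto simp: verts_crown_graph)
      from le(1)[OF this] show ?thesis unfolding Inl c(1)[OF \<open>i < 5\<close>] by simp
    next
      case (Inr i)
      then have "i < 5" using that by (auto simp: verts_crown_graph)
      from le(2)[OF this] show ?thesis unfolding Inr c(2)[OF \<open>i < 5\<close>] by simp
    qed
    \<comment> \<open>Firing backwards means using the negated indicator as script.\<close>
    then have "effective ?G (\<lambda>v. D v - E v - laplacian ?G (\<lambda>v. - of_bool (v \<in> ?U)) v)"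
      unfolding effective_def laplacian_minus by simp
    moreover have DE: "(\<lambda>v. D v - E v) \<in> divisors ?G" using D E(1) by (simp add: divisors_def)
    ultimately show ?thesis
      unfolding equiv_effective_iff[OF DE] by (intro exI[of _ "\<lambda>v. - of_bool (v \<in> ?U)"])
  qed
  moreover have "Inl 0 \<in> verts ?G" by (simp add: verts_crown_graph)
  ultimately show "2 \<le> div_rank ?G D" using div_rank_ge_iff[OF D, of "Inl 0" 2] by simp
qed

lemma gonality_2_crown_graph_5: "gonality 2 (crown_graph 5) = 8"
  unfolding gonality_def
proof (rule Least_equality)
  show "\<exists>D\<in>divisors (crown_graph 5). int 2 \<le> div_rank (crown_graph 5) D \<and> div_degree (crown_graph 5) D = 8"
    using degree_8_rank_ge_2 by simp
next
  fix d
  assume "\<exists>D\<in>divisors (crown_graph 5). int 2 \<le> div_rank (crown_graph 5) D \<and> div_degree (crown_graph 5) D = d"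
  then show "8 \<le> d" using degree_ge_8_if_rank_ge_2 by auto
qed

section \<open>Distances and \<open>alpha 2\<close>\<close>

lemma arcs_crown_graph:
  "e \<in> arcs (crown_graph n) \<longleftrightarrow>
     (\<exists>i<n. \<exists>j<n. i \<noteq> j \<and> (e = (Inl i, Inr j) \<or> e = (Inr i, Inl j)))"
  by (cases e) (auto simp: crown_graph_defs)

lemma graph_dist_le_length:
  assumes "wf_digraph G" "pre_digraph.awalk G u p v"
  shows "graph_dist G u v \<le> ereal (real (length p))"
  using wf_digraph.min_cost_le_walk_cost[OF assms, of "\<lambda>_. 1"]
  by (simp add: graph_dist_def wf_digraph.awalk_cost_def[OF assms(1)] sum_list_triv)

text \<open>Unmatched vertices on opposite sides are adjacent, and two vertices on one side have a
  common neighbour, since five indices leave a third one free.\<close>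

lemma graph_dist_crown_graph_le_2:
  assumes "v \<in> verts (crown_graph 5)" "w \<in> verts (crown_graph 5)"
    "\<And>i. (v, w) \<noteq> (Inl i, Inr i)" "\<And>i. (v, w) \<noteq> (Inr i, Inl i)"
  shows "graph_dist (crown_graph 5) v w \<le> 2"
proof -
  let ?G = "crown_graph 5"
  interpret graph ?G by (rule crown_graph)
  have ends: "tail ?G = fst" "head ?G = snd" by (simp_all add: crown_graph_defs)
  have third: "\<exists>k<5. k \<noteq> i \<and> k \<noteq> j" for i j :: nat
    by presburger
  have "\<exists>p. awalk v p w \<and> length p \<le> 2"
  proof (cases v; cases w)
    fix i j assume vw: "v = Inl i" "w = Inl j"
    obtain k where "k < 5" "k \<noteq> i" "k \<noteq> j" using third by blast
    then show ?thesis using assms vw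
      by (intro exI[of _ "[(Inl i, Inr k), (Inr k, Inl j)]"])
        (auto simp: awalk_def ends arcs_crown_graph verts_crown_graph)
  next
    fix i j assume vw: "v = Inr i" "w = Inr j"
    obtain k where "k < 5" "k \<noteq> i" "k \<noteq> j" using third by blast
    then show ?thesis using assms vw
      by (intro exI[of _ "[(Inr i, Inl k), (Inl k, Inr j)]"])
        (auto simp: awalk_def ends arcs_crown_graph verts_crown_graph)
  next
    fix i j assume "v = Inl i" "w = Inr j"
    then show ?thesis using assms
      by (intro exI[of _ "[(Inl i, Inr j)]"])
        (auto simp: awalk_def ends arcs_crown_graph verts_crown_graph)
  next
    fix i j assume "v = Inr i" "w = Inl j"
    then show ?thesis using assms
      by (intro exI[of _ "[(Inr i, Inl j)]"])
        (auto simp: awalk_def ends arcs_crown_graph verts_crown_graph)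
  qed
  then obtain p where "awalk v p w" "length p \<le> 2" by blast
  then show ?thesis
    using graph_dist_le_length[OF wf_digraph_axioms, of v p w] order_trans by fastforce
qed

text \<open>A walk between opposite sides has odd length, and length 1 would need a removed edge. If
  there is no walk at all, the infimum is infinite.\<close>

lemma graph_dist_crown_graph_matched:
  assumes "v = Inl i \<and> w = Inr i \<or> v = Inr i \<and> w = Inl i"
  shows "2 < graph_dist (crown_graph n) v w"
proof -
  let ?G = "crown_graph n"
  interpret graph ?G by (rule crown_graph)
  have ends: "tail ?G = fst" "head ?G = snd" by (simp_all add: crown_graph_defs)
  have "3 \<le> length p" if "awalk v p w" for p
  proof (rule ccontr)
    assume "\<not> ?thesis"
    then have "length p = 0 \<or> length p = 1 \<or> length p = 2" by linarith
    then consider "p = []" | e where "p = [e]" | e e' where "p = [e, e']"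
      by (auto simp: length_Suc_conv numeral_2_eq_2)
    then show False using that assms by cases (auto simp: awalk_def ends arcs_crown_graph)
  qed
  then have "ereal 3 \<le> graph_dist ?G v w"
    unfolding graph_dist_def \<mu>_def by (intro INF_greatest) (auto simp: awalk_cost_def sum_list_triv)
  then show ?thesis by (rule less_le_trans[rotated]) simp
qed

text \<open>A set of pairwise far vertices that contains \<open>v\<close> lies within
  \<open>v\<close> and its matched partner \<open>?v'\<close>; a matched pair attains the
  bound.\<close>

lemma alpha_2_crown_graph_5: "alpha 2 (crown_graph 5) = 2"
  unfolding alpha_def
proof (rule Max_eqI)
  let ?G = "crown_graph 5"
  let ?far = "\<lambda>S. S \<subseteq> verts ?G \<and> (\<forall>u\<in>S. \<forall>v\<in>S. u \<noteq> v \<longrightarrow> ereal (real 2) < graph_dist ?G u v)"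
  have fin: "finite (verts ?G)" by (simp add: verts_crown_graph)
  have "{card S |S. ?far S} \<subseteq> card ` Pow (verts ?G)" by auto
  then show "finite {card S |S. ?far S}" using fin finite_subset by blast
  show "m \<le> 2" if "m \<in> {card S |S. ?far S}" for m
  proof -
    from that have "\<exists>S. m = card S \<and> ?far S" by simp
    then obtain S where S: "m = card S" "?far S" by (elim exE conjE) simp
    show "m \<le> 2"
    proof (cases "S = {}")
      case False
      then obtain v where v: "v \<in> S" by blast
      let ?v' = "case v of Inl i \<Rightarrow> Inr i | Inr i \<Rightarrow> Inl i"
      have "S \<subseteq> {v, ?v'}"
      proof
        fix w assume w: "w \<in> S"
        show "w \<in> {v, ?v'}"
        proof (rule ccontr)
          assume "w \<notin> {v, ?v'}"
          then have "graph_dist ?G v w \<le> 2"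
            using S(2) v w by (intro graph_dist_crown_graph_le_2) auto
          moreover have "2 < graph_dist ?G v w" using S(2) v w \<open>w \<notin> {v, ?v'}\<close> by auto
          ultimately show False by simp
        qed
      qed
      then have "card S \<le> card {v, ?v'}" by (intro card_mono) auto
      also have "\<dots> \<le> 2" by (simp add: card_insert_if)
      finally show ?thesis using S(1) by simp
    qed (use S(1) in simp)
  qed
  have "?far {Inl 0, Inr 0}"
    using graph_dist_crown_graph_matched[of _ 0] by (auto simp: verts_crown_graph)
  moreover have "card {Inl 0 :: nat + nat, Inr 0} = 2" by simp
  ultimately show "2 \<in> {card S |S. ?far S}"
    by (intro CollectI exI[of _ "{Inl 0, Inr 0}"]) simp
qed

theorem theorem3p3:
  shows "gonality 2 (crown_graph 5) = 10 - int (alpha 2 (crown_graph 5))"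
  by (simp add: gonality_2_crown_graph_5 alpha_2_crown_graph_5)

end
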